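(* The two notions of lax monoidal functor coincide, under the correspondence between LR units and Saavedra units. That is, let $\mathscr{C}$ and $\mathscr{D}$ be monoidal categories with units $I$ and $J$ respectively, let $(F,\phi_2):\mathscr{C}\to\mathscr{D}$ be a lax multiplicative functor, and let $\phi_0:J\to F(I)$ be an arrow of $\mathscr{D}$. Then $\phi_0$ is an LR-unit compatibility for $F$ if and only if it is a Saavedra-unit compatibility for $F$.
   Context: A semi-monoidal category is a category with a strictly associative functor $\mathscr{C}\times\mathscr{C}\to\mathscr{C}$, written as juxtaposition. The identity arrow of an object $X$ is also written $X$. An LR unit is a triple $(I,\lambda,\rho)$ with $\lambda_X: IX\to X$, $\rho_X: XI\to X$ natural isomorphisms satisfying, for all $X,Y$: $\lambda_I=\rho_I$; $\lambda_{XY}=\lambda_X Y$; $\rho_{XY}=X\rho_Y$; $X\lambda_Y=\rho_X Y$. A Saavedra unit is a pair $(I,\alpha)$ where $\alpha:II\to I$ is an isomorphism and the functors $X\mapsto IX$, $X\mapsto XI$ are fully faithful. The two structures on an object $I$ correspond bijectively via $\alpha=\lambda_I=\rho_I$, resp. $I\lambda_X=\alpha X$, $\rho_XI=X\alpha$. A monoidal category is a semi-monoidal category with a unit, carrying both corresponding structures: $(I,\lambda^I,\rho^I)$, $(I,\alpha)$ for $\mathscr{C}$ and $(J,\lambda^J,\rho^J)$, $(J,\beta)$ for $\mathscr{D}$. A lax multiplicative functor $(F,\phi_2)$ is a functor $F$ with a natural family of arrows (not necessarily invertible) $\phi_{X,Y}:F(X)F(Y)\to F(XY)$ such that $\phi_{XY,Z}\circ(\phi_{X,Y}F(Z))=\phi_{X,YZ}\circ(F(X)\phi_{Y,Z})$.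 The arrow $\phi_0:J\to F(I)$ (not necessarily invertible) is an LR-unit compatibility if for every object $X$ of $\mathscr{C}$: $\lambda^J_{F(X)}=F(\lambda^I_X)\circ\phi_{I,X}\circ(\phi_0F(X))$ and $\rho^J_{F(X)}=F(\rho^I_X)\circ\phi_{X,I}\circ(F(X)\phi_0)$. It is a Saavedra-unit compatibility if: (a) it is a semi-monoid homomorphism: $\phi_0\circ\beta=F(\alpha)\circ\phi_{I,I}\circ(\phi_0\phi_0)$; (b) it is gentle: the composites $F(\alpha)\circ\phi_{I,I}\circ(\phi_0F(I)):JF(I)\to F(I)$ and $F(\alpha)\circ\phi_{I,I}\circ(F(I)\phi_0):F(I)J\to F(I)$ are monomorphisms; (c) $\phi_{I,X}:F(I)F(X)\to F(IX)$ and $\phi_{X,I}:F(X)F(I)\to F(XI)$ are epimorphisms for all objects $X$ of $\mathscr{C}$. A lax monoidal functor in the LR (resp. Saavedra-unit) sense is a lax multiplicative functor with an LR-unit (resp. Saavedra-unit) compatibility. *)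

theory Defs
  imports Main
begin

record ('o, 'a) category =
  Obj :: "'o set"
  Arr :: "'a set"
  Dom :: "'a \<Rightarrow> 'o"
  Cod :: "'a \<Rightarrow> 'o"
  Ident :: "'o \<Rightarrow> 'a"
  Comp :: "'a \<Rightarrow> 'a \<Rightarrow> 'a"  (infixr "\<cdot>\<index>" 55)

text \<open>Composition is in applicative order: \<open>g \<cdot> f\<close> is \<open>g\<close> after \<open>f\<close>.\<close>

definition hom :: "('o, 'a, 'm) category_scheme \<Rightarrow> 'o \<Rightarrow> 'o \<Rightarrow> 'a set" where
  "hom C X Y = {f \<in> Arr C. Dom C f = X \<and> Cod C f = Y}"

locale category =
  fixes C :: "('o, 'a, 'm) category_scheme" (structure)
  assumes dom_closed: "f \<in> Arr C \<Longrightarrow> Dom C f \<in> Obj C"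
    and cod_closed: "f \<in> Arr C \<Longrightarrow> Cod C f \<in> Obj C"
    and ident_in_hom: "X \<in> Obj C \<Longrightarrow> Ident C X \<in> hom C X X"
    and comp_in_hom: "\<lbrakk>f \<in> hom C X Y; g \<in> hom C Y Z\<rbrakk> \<Longrightarrow> g \<cdot> f \<in> hom C X Z"
    and comp_ident_left: "f \<in> hom C X Y \<Longrightarrow> Ident C Y \<cdot> f = f"
    and comp_ident_right: "f \<in> hom C X Y \<Longrightarrow> f \<cdot> Ident C X = f"
    and comp_assoc: "\<lbrakk>f \<in> hom C W X; g \<in> hom C X Y; h \<in> hom C Y Z\<rbrakk>
      \<Longrightarrow> (h \<cdot> g) \<cdot> f = h \<cdot> (g \<cdot> f)"

definition isomorphism :: "('o, 'a, 'm) category_scheme \<Rightarrow> 'a \<Rightarrow> bool" where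
  "isomorphism C f \<longleftrightarrow> f \<in> Arr C \<and>
    (\<exists>g \<in> hom C (Cod C f) (Dom C f).
      g \<cdot>\<^bsub>C\<^esub> f = Ident C (Dom C f) \<and> f \<cdot>\<^bsub>C\<^esub> g = Ident C (Cod C f))"

definition monomorphism :: "('o, 'a, 'm) category_scheme \<Rightarrow> 'a \<Rightarrow> bool" where
  "monomorphism C f \<longleftrightarrow> f \<in> Arr C \<and>
    (\<forall>W \<in> Obj C. \<forall>g \<in> hom C W (Dom C f). \<forall>h \<in> hom C W (Dom C f).
      f \<cdot>\<^bsub>C\<^esub> g = f \<cdot>\<^bsub>C\<^esub> h \<longrightarrow> g = h)"

definition epimorphism :: "('o, 'a, 'm) category_scheme \<Rightarrow> 'a \<Rightarrow> bool" where
  "epimorphism C f \<longleftrightarrow> f \<in> Arr C \<and>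
    (\<forall>Z \<in> Obj C. \<forall>g \<in> hom C (Cod C f) Z. \<forall>h \<in> hom C (Cod C f) Z.
      g \<cdot>\<^bsub>C\<^esub> f = h \<cdot>\<^bsub>C\<^esub> f \<longrightarrow> g = h)"

record ('o, 'a, 'p, 'b) functor_maps =
  OMap :: "'o \<Rightarrow> 'p"
  AMap :: "'a \<Rightarrow> 'b"

locale category_functor = source: category C + target: category D
  for C :: "('o, 'a, 'm) category_scheme"
    and D :: "('p, 'b, 'n) category_scheme"
    and F :: "('o, 'a, 'p, 'b) functor_maps" +
  assumes omap_closed: "X \<in> Obj C \<Longrightarrow> OMap F X \<in> Obj D"
    and amap_in_hom: "f \<in> hom C X Y \<Longrightarrow> AMap F f \<in> hom D (OMap F X) (OMap F Y)"
    and amap_ident: "X \<in> Obj C \<Longrightarrow> AMap F (Ident C X) = Ident D (OMap F X)"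
    and amap_comp: "\<lbrakk>f \<in> hom C X Y; g \<in> hom C Y Z\<rbrakk>
      \<Longrightarrow> AMap F (g \<cdot>\<^bsub>C\<^esub> f) = AMap F g \<cdot>\<^bsub>D\<^esub> AMap F f"

definition fully_faithful ::
  "('o, 'a, 'm) category_scheme \<Rightarrow> ('p, 'b, 'n) category_scheme
    \<Rightarrow> ('o, 'a, 'p, 'b) functor_maps \<Rightarrow> bool" where
  "fully_faithful C D F \<longleftrightarrow> category_functor C D F \<and>
    (\<forall>X \<in> Obj C. \<forall>Y \<in> Obj C.
      bij_betw (AMap F) (hom C X Y) (hom D (OMap F X) (OMap F Y)))"

definition id_functor :: "('o, 'a, 'o, 'a) functor_maps" where
  "id_functor = \<lparr>OMap = (\<lambda>X. X), AMap = (\<lambda>f. f)\<rparr>"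

definition comp_functor ::
  "('p, 'b, 'q, 'c) functor_maps \<Rightarrow> ('o, 'a, 'p, 'b) functor_maps
    \<Rightarrow> ('o, 'a, 'q, 'c) functor_maps" where
  "comp_functor G F = \<lparr>OMap = OMap G \<circ> OMap F, AMap = AMap G \<circ> AMap F\<rparr>"

definition product_category ::
  "('o, 'a, 'm) category_scheme \<Rightarrow> ('p, 'b, 'n) category_scheme
    \<Rightarrow> ('o \<times> 'p, 'a \<times> 'b) category" where
  "product_category C D =
    \<lparr>Obj = Obj C \<times> Obj D,
     Arr = Arr C \<times> Arr D,
     Dom = map_prod (Dom C) (Dom D),
     Cod = map_prod (Cod C) (Cod D),
     Ident = map_prod (Ident C) (Ident D),
     Comp = (\<lambda>(g, g') (f, f'). (g \<cdot>\<^bsub>C\<^esub> f, g' \<cdot>\<^bsub>D\<^esub> f'))\<rparr>"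

definition product_functor ::
  "('o, 'a, 'p, 'b) functor_maps \<Rightarrow> ('o2, 'a2, 'p2, 'b2) functor_maps
    \<Rightarrow> ('o \<times> 'o2, 'a \<times> 'a2, 'p \<times> 'p2, 'b \<times> 'b2) functor_maps" where
  "product_functor F G =
    \<lparr>OMap = map_prod (OMap F) (OMap G), AMap = map_prod (AMap F) (AMap G)\<rparr>"

locale natural_transformation =
  F: category_functor C D F + G: category_functor C D G
  for C :: "('o, 'a, 'm) category_scheme"
    and D :: "('p, 'b, 'n) category_scheme"
    and F G :: "('o, 'a, 'p, 'b) functor_maps"
    and \<eta> :: "'o \<Rightarrow> 'b" +
  assumes component_in_hom: "X \<in> Obj C \<Longrightarrow> \<eta> X \<in> hom D (OMap F X) (OMap G X)"
    and naturality: "f \<in> hom C X Y \<Longrightarrow> \<eta> Y \<cdot>\<^bsub>D\<^esub> AMap F f = AMap G f \<cdot>\<^bsub>D\<^esub> \<eta> X"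

locale natural_isomorphism = natural_transformation +
  assumes component_iso: "X \<in> Obj C \<Longrightarrow> isomorphism D (\<eta> X)"

record ('o, 'a) semi_monoidal_category = "('o, 'a) category" +
  Tensor :: "('o \<times> 'o, 'a \<times> 'a, 'o, 'a) functor_maps"

definition tensor_obj ::
  "('o, 'a, 'm) semi_monoidal_category_scheme \<Rightarrow> 'o \<Rightarrow> 'o \<Rightarrow> 'o"  (infixr "\<otimes>\<index>" 70) where
  "X \<otimes>\<^bsub>C\<^esub> Y = OMap (Tensor C) (X, Y)"

definition tensor_arr ::
  "('o, 'a, 'm) semi_monoidal_category_scheme \<Rightarrow> 'a \<Rightarrow> 'a \<Rightarrow> 'a"  (infixr "\<odot>\<index>" 70) where
  "f \<odot>\<^bsub>C\<^esub> g = AMap (Tensor C) (f, g)"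

locale semi_monoidal_category =
  category C + tensor: category_functor "product_category C C" C "Tensor C"
  for C :: "('o, 'a, 'm) semi_monoidal_category_scheme" (structure) +
  assumes tensor_obj_assoc: "\<lbrakk>X \<in> Obj C; Y \<in> Obj C; Z \<in> Obj C\<rbrakk>
      \<Longrightarrow> (X \<otimes> Y) \<otimes> Z = X \<otimes> (Y \<otimes> Z)"
    and tensor_arr_assoc: "\<lbrakk>f \<in> Arr C; g \<in> Arr C; h \<in> Arr C\<rbrakk>
      \<Longrightarrow> (f \<odot> g) \<odot> h = f \<odot> (g \<odot> h)"

definition left_tensor ::
  "('o, 'a, 'm) semi_monoidal_category_scheme \<Rightarrow> 'o \<Rightarrow> ('o, 'a, 'o, 'a) functor_maps" where
  "left_tensor C I = \<lparr>OMap = (\<lambda>X. I \<otimes>\<^bsub>C\<^esub> X), AMap = (\<lambda>f. Ident C I \<odot>\<^bsub>C\<^esub> f)\<rparr>"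

definition right_tensor ::
  "('o, 'a, 'm) semi_monoidal_category_scheme \<Rightarrow> 'o \<Rightarrow> ('o, 'a, 'o, 'a) functor_maps" where
  "right_tensor C I = \<lparr>OMap = (\<lambda>X. X \<otimes>\<^bsub>C\<^esub> I), AMap = (\<lambda>f. f \<odot>\<^bsub>C\<^esub> Ident C I)\<rparr>"

definition LR_unit ::
  "('o, 'a, 'm) semi_monoidal_category_scheme \<Rightarrow> 'o \<Rightarrow> ('o \<Rightarrow> 'a) \<Rightarrow> ('o \<Rightarrow> 'a) \<Rightarrow> bool" where
  "LR_unit C I l r \<longleftrightarrow> I \<in> Obj C \<and>
    natural_isomorphism C C (left_tensor C I) id_functor l \<and>
    natural_isomorphism C C (right_tensor C I) id_functor r \<and>
    l I = r I \<and>
    (\<forall>X \<in> Obj C. \<forall>Y \<in> Obj C.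
      l (X \<otimes>\<^bsub>C\<^esub> Y) = l X \<odot>\<^bsub>C\<^esub> Ident C Y \<and>
      r (X \<otimes>\<^bsub>C\<^esub> Y) = Ident C X \<odot>\<^bsub>C\<^esub> r Y \<and>
      Ident C X \<odot>\<^bsub>C\<^esub> l Y = r X \<odot>\<^bsub>C\<^esub> Ident C Y)"

definition Saavedra_unit ::
  "('o, 'a, 'm) semi_monoidal_category_scheme \<Rightarrow> 'o \<Rightarrow> 'a \<Rightarrow> bool" where
  "Saavedra_unit C I a \<longleftrightarrow> I \<in> Obj C \<and>
    a \<in> hom C (I \<otimes>\<^bsub>C\<^esub> I) I \<and> isomorphism C a \<and>
    fully_faithful C C (left_tensor C I) \<and>
    fully_faithful C C (right_tensor C I)"

text \<open>The first conjunct determines \<open>a\<close> from \<open>(l, r)\<close>; the second determines \<open>(l, r)\<close> (on objects)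
  from \<open>a\<close>, since tensoring with \<open>I\<close> is fully faithful.\<close>

definition corresponding_units ::
  "('o, 'a, 'm) semi_monoidal_category_scheme
    \<Rightarrow> 'o \<Rightarrow> ('o \<Rightarrow> 'a) \<Rightarrow> ('o \<Rightarrow> 'a) \<Rightarrow> 'a \<Rightarrow> bool" where
  "corresponding_units C I l r a \<longleftrightarrow>
    (a = l I \<and> a = r I) \<and>
    (\<forall>X \<in> Obj C. Ident C I \<odot>\<^bsub>C\<^esub> l X = a \<odot>\<^bsub>C\<^esub> Ident C X \<and>
                 r X \<odot>\<^bsub>C\<^esub> Ident C I = Ident C X \<odot>\<^bsub>C\<^esub> a)"

text \<open>A monoidal category carries both corresponding unit structures on the object \<open>Unit\<close>: the
  LR structure \<open>(LUnit, RUnit)\<close> and the Saavedra structure \<open>UnitMult\<close>.\<close>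

record ('o, 'a) monoidal_category = "('o, 'a) semi_monoidal_category" +
  Unit :: 'o
  LUnit :: "'o \<Rightarrow> 'a"
  RUnit :: "'o \<Rightarrow> 'a"
  UnitMult :: 'a

locale monoidal_category = semi_monoidal_category C
  for C :: "('o, 'a, 'm) monoidal_category_scheme" (structure) +
  assumes LR: "LR_unit C (Unit C) (LUnit C) (RUnit C)"
    and Saavedra: "Saavedra_unit C (Unit C) (UnitMult C)"
    and corresponding: "corresponding_units C (Unit C) (LUnit C) (RUnit C) (UnitMult C)"

text \<open>The family \<open>\<phi>\<close> is a natural transformation between functors on the product category,
  from \<open>(X, Y) \<mapsto> F X \<otimes> F Y\<close> to \<open>(X, Y) \<mapsto> F (X \<otimes> Y)\<close>.\<close>

locale lax_multiplicative_functor =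
  source: semi_monoidal_category C + target: semi_monoidal_category D +
  category_functor C D F +
  mult: natural_transformation "product_category C C" D
    "comp_functor (Tensor D) (product_functor F F)" "comp_functor F (Tensor C)" \<phi>
  for C :: "('o, 'a, 'm) semi_monoidal_category_scheme"
    and D :: "('p, 'b, 'n) semi_monoidal_category_scheme"
    and F :: "('o, 'a, 'p, 'b) functor_maps"
    and \<phi> :: "'o \<times> 'o \<Rightarrow> 'b" +
  assumes mult_assoc: "\<lbrakk>X \<in> Obj C; Y \<in> Obj C; Z \<in> Obj C\<rbrakk> \<Longrightarrow>
    \<phi> (X \<otimes>\<^bsub>C\<^esub> Y, Z) \<cdot>\<^bsub>D\<^esub> (\<phi> (X, Y) \<odot>\<^bsub>D\<^esub> Ident D (OMap F Z)) =
    \<phi> (X, Y \<otimes>\<^bsub>C\<^esub> Z) \<cdot>\<^bsub>D\<^esub> (Ident D (OMap F X) \<odot>\<^bsub>D\<^esub> \<phi> (Y, Z))"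

definition LR_unit_compatibility ::
  "('o, 'a, 'm) monoidal_category_scheme \<Rightarrow> ('p, 'b, 'n) monoidal_category_scheme
    \<Rightarrow> ('o, 'a, 'p, 'b) functor_maps \<Rightarrow> ('o \<times> 'o \<Rightarrow> 'b) \<Rightarrow> 'b \<Rightarrow> bool" where
  "LR_unit_compatibility C D F \<phi> \<phi>0 \<longleftrightarrow>
    \<phi>0 \<in> hom D (Unit D) (OMap F (Unit C)) \<and>
    (\<forall>X \<in> Obj C.
      LUnit D (OMap F X) =
        AMap F (LUnit C X) \<cdot>\<^bsub>D\<^esub> \<phi> (Unit C, X) \<cdot>\<^bsub>D\<^esub> (\<phi>0 \<odot>\<^bsub>D\<^esub> Ident D (OMap F X)) \<and>
      RUnit D (OMap F X) =
        AMap F (RUnit C X) \<cdot>\<^bsub>D\<^esub> \<phi> (X, Unit C) \<cdot>\<^bsub>D\<^esub> (Ident D (OMap F X) \<odot>\<^bsub>D\<^esub> \<phi>0))"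

definition semi_monoid_hom ::
  "('o, 'a, 'm) monoidal_category_scheme \<Rightarrow> ('p, 'b, 'n) monoidal_category_scheme
    \<Rightarrow> ('o, 'a, 'p, 'b) functor_maps \<Rightarrow> ('o \<times> 'o \<Rightarrow> 'b) \<Rightarrow> 'b \<Rightarrow> bool" where
  "semi_monoid_hom C D F \<phi> \<phi>0 \<longleftrightarrow>
    \<phi>0 \<cdot>\<^bsub>D\<^esub> UnitMult D =
      AMap F (UnitMult C) \<cdot>\<^bsub>D\<^esub> \<phi> (Unit C, Unit C) \<cdot>\<^bsub>D\<^esub> (\<phi>0 \<odot>\<^bsub>D\<^esub> \<phi>0)"

definition gentle ::
  "('o, 'a, 'm) monoidal_category_scheme \<Rightarrow> ('p, 'b, 'n) monoidal_category_scheme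
    \<Rightarrow> ('o, 'a, 'p, 'b) functor_maps \<Rightarrow> ('o \<times> 'o \<Rightarrow> 'b) \<Rightarrow> 'b \<Rightarrow> bool" where
  "gentle C D F \<phi> \<phi>0 \<longleftrightarrow>
    monomorphism D (AMap F (UnitMult C) \<cdot>\<^bsub>D\<^esub> \<phi> (Unit C, Unit C) \<cdot>\<^bsub>D\<^esub>
      (\<phi>0 \<odot>\<^bsub>D\<^esub> Ident D (OMap F (Unit C)))) \<and>
    monomorphism D (AMap F (UnitMult C) \<cdot>\<^bsub>D\<^esub> \<phi> (Unit C, Unit C) \<cdot>\<^bsub>D\<^esub>
      (Ident D (OMap F (Unit C)) \<odot>\<^bsub>D\<^esub> \<phi>0))"

definition Saavedra_unit_compatibility ::
  "('o, 'a, 'm) monoidal_category_scheme \<Rightarrow> ('p, 'b, 'n) monoidal_category_scheme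
    \<Rightarrow> ('o, 'a, 'p, 'b) functor_maps \<Rightarrow> ('o \<times> 'o \<Rightarrow> 'b) \<Rightarrow> 'b \<Rightarrow> bool" where
  "Saavedra_unit_compatibility C D F \<phi> \<phi>0 \<longleftrightarrow>
    \<phi>0 \<in> hom D (Unit D) (OMap F (Unit C)) \<and>
    semi_monoid_hom C D F \<phi> \<phi>0 \<and>
    gentle C D F \<phi> \<phi>0 \<and>
    (\<forall>X \<in> Obj C. epimorphism D (\<phi> (Unit C, X)) \<and> epimorphism D (\<phi> (X, Unit C)))"

end

theory Submission imports Defs begin

text \<open>
  Write \<open>m = F(\<alpha>) \<circ> \<phi>\<^sub>I\<^sub>,\<^sub>I\<close>, an associative multiplication on \<open>F(I)\<close>, and
  \<open>e\<^sub>X = F(\<lambda>\<^sub>X) \<circ> \<phi>\<^sub>I\<^sub>,\<^sub>X \<circ> (\<phi>\<^sub>0 F(X))\<close>. If \<open>\<phi>\<^sub>0\<close> is an LR compatibility, (a) is naturality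
  of \<open>\<lambda>\<^sup>J\<close>, the composites in (b) are \<open>\<lambda>\<^sup>J\<close> and \<open>\<rho>\<^sup>J\<close> at \<open>F(I)\<close>, and (c) holds since
  \<open>F(\<lambda>\<^sub>X) \<circ> \<phi>\<^sub>I\<^sub>,\<^sub>X \<circ> (\<phi>\<^sub>0 F(X))\<close> is invertible, so that \<open>\<phi>\<^sub>I\<^sub>,\<^sub>X\<close> has a right inverse.
  Conversely, associativity of \<open>m\<close> and (a) give \<open>e\<^sub>I \<circ> (J e\<^sub>I) = e\<^sub>I \<circ> (\<beta> F(I)) = e\<^sub>I \<circ> (J \<lambda>\<^sup>J)\<close>;
  cancelling the monomorphism \<open>e\<^sub>I\<close> and then \<open>J\<close> gives \<open>e\<^sub>I = \<lambda>\<^sup>J\<close>. By associativity of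
  \<open>\<phi>\<close>, the maps \<open>e\<^bsub>IX\<^esub>\<close> and \<open>\<lambda>\<^sup>J\<close> agree after precomposition with the epimorphism
  \<open>J \<phi>\<^sub>I\<^sub>,\<^sub>X\<close>, hence agree, and naturality of \<open>e\<close> along \<open>\<lambda>\<^sub>X\<close> transports this to \<open>X\<close>.
\<close>

text \<open>Typing is handled by separate rewrite rules for \<open>Arr\<close>, \<open>Dom\<close>
  and \<open>Cod\<close>, so that the simplifier can discharge it; this lemma and
  \<open>homD\<close> translate from and to \<open>hom\<close>.\<close>

lemma homI: "\<lbrakk>f \<in> Arr C; Dom C f = X; Cod C f = Y\<rbrakk> \<Longrightarrow> f \<in> hom C X Y"
  by (simp add: hom_def)

lemma homD:
  assumes "f \<in> hom C X Y"
  shows "f \<in> Arr C" "Dom C f = X" "Cod C f = Y"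
  using assms by (simp_all add: hom_def)

section \<open>Categories and functors\<close>

context category
begin

declare dom_closed [simp] cod_closed [simp]

lemma ident_simps [simp]:
  assumes "X \<in> Obj C"
  shows "Ident C X \<in> Arr C" "Dom C (Ident C X) = X" "Cod C (Ident C X) = X"
  using homD [OF ident_in_hom [OF assms]] by simp_all

lemma comp_simps [simp]:
  assumes "f \<in> Arr C" "g \<in> Arr C" "Dom C g = Cod C f"
  shows "g \<cdot> f \<in> Arr C" "Dom C (g \<cdot> f) = Dom C f" "Cod C (g \<cdot> f) = Cod C g"
  using homD [OF comp_in_hom [OF homI homI, of f _ _ g]] assms by simp_all

lemma ident_comp [simp]: "\<lbrakk>f \<in> Arr C; Cod C f = X\<rbrakk> \<Longrightarrow> Ident C X \<cdot> f = f"
  by (rule comp_ident_left [OF homI]) auto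

lemma comp_ident [simp]: "\<lbrakk>f \<in> Arr C; Dom C f = X\<rbrakk> \<Longrightarrow> f \<cdot> Ident C X = f"
  by (rule comp_ident_right [OF homI]) auto

lemma assoc:
  "\<lbrakk>f \<in> Arr C; g \<in> Arr C; h \<in> Arr C; Dom C g = Cod C f; Dom C h = Cod C g\<rbrakk>
    \<Longrightarrow> (h \<cdot> g) \<cdot> f = h \<cdot> (g \<cdot> f)"
  by (rule comp_assoc [OF homI homI homI]) auto

section \<open>Isomorphisms, monomorphisms and epimorphisms\<close>

lemma isoE:
  assumes "isomorphism C f"
  obtains g where "g \<in> Arr C" "Dom C g = Cod C f" "Cod C g = Dom C f"
    "g \<cdot> f = Ident C (Dom C f)" "f \<cdot> g = Ident C (Cod C f)"
  using assms unfolding isomorphism_def hom_def by auto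

lemma iso_arr: "isomorphism C f \<Longrightarrow> f \<in> Arr C"
  by (simp add: isomorphism_def)

lemma monoD:
  assumes "monomorphism C f" "g \<in> Arr C" "h \<in> Arr C" "Cod C g = Dom C f" "Cod C h = Dom C f"
    "Dom C g = Dom C h" "f \<cdot> g = f \<cdot> h"
  shows "g = h"
  using assms homI [of g C] homI [of h C] unfolding monomorphism_def by (metis dom_closed)

lemma epiD:
  assumes "epimorphism C f" "g \<in> Arr C" "h \<in> Arr C" "Dom C g = Cod C f" "Dom C h = Cod C f"
    "Cod C g = Cod C h" "g \<cdot> f = h \<cdot> f"
  shows "g = h"
  using assms homI [of g C] homI [of h C] unfolding epimorphism_def by (metis cod_closed)

lemma epi_if_right_inverse:
  assumes "f \<in> Arr C" "s \<in> Arr C" "Cod C s = Dom C f" "f \<cdot> s = Ident C (Cod C f)"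
  shows "epimorphism C f"
  unfolding epimorphism_def
proof (intro conjI ballI impI)
  fix Z g h
  assume "g \<in> hom C (Cod C f) Z" "h \<in> hom C (Cod C f) Z" and eq: "g \<cdot> f = h \<cdot> f"
  then have g: "g \<in> Arr C" "Dom C g = Cod C f" and h: "h \<in> Arr C" "Dom C h = Cod C f"
    by (simp_all add: hom_def)
  have "g = (g \<cdot> f) \<cdot> s" using g assms by (simp add: assoc)
  also have "\<dots> = (h \<cdot> f) \<cdot> s" by (simp only: eq)
  also have "\<dots> = h" using h assms by (simp add: assoc)
  finally show "g = h" .
qed (fact assms)

lemma iso_epi: "isomorphism C f \<Longrightarrow> epimorphism C f"
  by (metis epi_if_right_inverse isoE iso_arr)

lemma mono_if_left_inverse:
  assumes "f \<in> Arr C" "r \<in> Arr C" "Dom C r = Cod C f" "r \<cdot> f = Ident C (Dom C f)"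
  shows "monomorphism C f"
  unfolding monomorphism_def
proof (intro conjI ballI impI)
  fix W g h
  assume "g \<in> hom C W (Dom C f)" "h \<in> hom C W (Dom C f)" and eq: "f \<cdot> g = f \<cdot> h"
  then have g: "g \<in> Arr C" "Cod C g = Dom C f" and h: "h \<in> Arr C" "Cod C h = Dom C f"
    by (simp_all add: hom_def)
  have "g = r \<cdot> (f \<cdot> g)" using g assms by (simp flip: assoc)
  also have "\<dots> = r \<cdot> (f \<cdot> h)" by (simp only: eq)
  also have "\<dots> = h" using h assms by (simp flip: assoc)
  finally show "g = h" .
qed (fact assms)

lemma iso_mono: "isomorphism C f \<Longrightarrow> monomorphism C f"
  by (metis mono_if_left_inverse isoE iso_arr)

lemma epi_arr: "epimorphism C f \<Longrightarrow> f \<in> Arr C"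
  by (simp add: epimorphism_def)

text \<open>Since \<open>v\<close> is invertible, \<open>f\<close> is the inverse of
  \<open>v\<close> after \<open>f'\<close> after \<open>u\<close>, a composite of
  epimorphisms.\<close>

lemma epi_if_iso_conjugate:
  assumes f: "f \<in> Arr C" "epimorphism C f'"
    and u: "isomorphism C u" "Dom C u = Dom C f" "Cod C u = Dom C f'"
    and v: "isomorphism C v" "Dom C v = Cod C f" "Cod C v = Cod C f'"
    and sq: "v \<cdot> f = f' \<cdot> u"
  shows "epimorphism C f"
  unfolding epimorphism_def
proof (intro conjI ballI impI)
  fix Z g h
  assume "g \<in> hom C (Cod C f) Z" "h \<in> hom C (Cod C f) Z" and eq: "g \<cdot> f = h \<cdot> f"
  then have gh: "g \<in> Arr C" "Dom C g = Cod C f" "h \<in> Arr C" "Dom C h = Cod C f"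
    "Cod C g = Cod C h"
    by (simp_all add: hom_def)
  obtain w where w: "w \<in> Arr C" "Dom C w = Cod C f'" "Cod C w = Cod C f"
    "w \<cdot> v = Ident C (Cod C f)" "v \<cdot> w = Ident C (Cod C f')"
    using isoE [OF v(1)] v by metis
  note arr = f(1) epi_arr [OF f(2)] iso_arr [OF u(1)] iso_arr [OF v(1)]
  \<comment> \<open>With \<open>w\<close> the inverse of \<open>v\<close>, this rewrites
    \<open>k \<cdot> f\<close> so that first \<open>u\<close> and then \<open>f'\<close> can be
    cancelled on the right.\<close>
  have *: "((k \<cdot> w) \<cdot> f') \<cdot> u = k \<cdot> f" if "k \<in> Arr C" "Dom C k = Cod C f" for k
  proof -
    have "((k \<cdot> w) \<cdot> f') \<cdot> u = (k \<cdot> w) \<cdot> (v \<cdot> f)"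
      using that w u arr by (simp add: assoc sq)
    also have "\<dots> = k \<cdot> ((w \<cdot> v) \<cdot> f)"
      using that w(1-3) v arr by (simp add: assoc)
    also have "\<dots> = k \<cdot> f" using w(4) arr by simp
    finally show ?thesis .
  qed
  have "(g \<cdot> w) \<cdot> f' = (h \<cdot> w) \<cdot> f'"
    by (rule epiD [OF iso_epi [OF u(1)]]) (use * gh w u arr eq in simp_all)
  then have gw: "g \<cdot> w = h \<cdot> w"
    by (rule epiD [OF f(2), rotated -1]) (use gh w in simp_all)
  have "g = (g \<cdot> w) \<cdot> v" using gh w v arr by (simp add: assoc)
  also have "\<dots> = (h \<cdot> w) \<cdot> v" by (simp only: gw)
  also have "\<dots> = h" using gh w v arr by (simp add: assoc)
  finally show "g = h" .
qed (fact f)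

text \<open>If \<open>k\<close> inverts the whole composite, then
  \<open>f \<cdot> k \<cdot> h\<close> is a right inverse of the middle factor \<open>g\<close>.
  This produces the epimorphisms of condition (c).\<close>

lemma epi_if_iso_composite:
  assumes arr: "f \<in> Arr C" "g \<in> Arr C" "h \<in> Arr C" "Dom C g = Cod C f" "Dom C h = Cod C g"
    and h: "isomorphism C h" and hgf: "isomorphism C (h \<cdot> g \<cdot> f)"
  shows "epimorphism C g"
proof -
  obtain k where k: "k \<in> Arr C" "Dom C k = Cod C h" "Cod C k = Dom C f"
    "(h \<cdot> g \<cdot> f) \<cdot> k = Ident C (Cod C h)"
    using isoE [OF hgf] arr by (metis comp_simps)
  have "g \<cdot> (f \<cdot> k \<cdot> h) = Ident C (Cod C g)"
  \<comment> \<open>The equation is checked after composing with the monomorphism \<open>h\<close>,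
    where the composite with \<open>k\<close> collapses to an identity.\<close>
  proof (rule monoD [OF iso_mono [OF h]])
    have "h \<cdot> g \<cdot> (f \<cdot> k \<cdot> h) = ((h \<cdot> g \<cdot> f) \<cdot> k) \<cdot> h"
      using arr k(1-3) by (simp add: assoc)
    also have "\<dots> = h \<cdot> Ident C (Cod C g)" using arr k(4) by simp
    finally show "h \<cdot> g \<cdot> (f \<cdot> k \<cdot> h) = h \<cdot> Ident C (Cod C g)" .
  qed (use arr k(1-3) in simp_all)
  then show ?thesis
    by (rule epi_if_right_inverse [rotated -1]) (use arr k(1-3) in simp_all)
qed

end

context category_functor
begin

declare omap_closed [simp]

lemma amap_simps [simp]:
  assumes "f \<in> Arr C"
  shows "AMap F f \<in> Arr D" "Dom D (AMap F f) = OMap F (Dom C f)"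
    "Cod D (AMap F f) = OMap F (Cod C f)"
  using homD [OF amap_in_hom [OF homI]] assms by simp_all

declare amap_ident [simp]

lemma amap_compose:
  "\<lbrakk>f \<in> Arr C; g \<in> Arr C; Dom C g = Cod C f\<rbrakk>
    \<Longrightarrow> AMap F (g \<cdot>\<^bsub>C\<^esub> f) = AMap F g \<cdot>\<^bsub>D\<^esub> AMap F f"
  by (rule amap_comp [OF homI homI]) auto

lemma amap_iso:
  assumes "isomorphism C f"
  shows "isomorphism D (AMap F f)"
proof -
  have f: "f \<in> Arr C" using assms by (rule source.iso_arr)
  obtain g where g: "g \<in> Arr C" "Dom C g = Cod C f" "Cod C g = Dom C f"
    "g \<cdot>\<^bsub>C\<^esub> f = Ident C (Dom C f)" "f \<cdot>\<^bsub>C\<^esub> g = Ident C (Cod C f)"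
    using assms by (rule source.isoE)
  have "AMap F g \<in> hom D (OMap F (Cod C f)) (OMap F (Dom C f))"
    using g by (simp add: hom_def)
  moreover have "AMap F g \<cdot>\<^bsub>D\<^esub> AMap F f = Ident D (OMap F (Dom C f))"
    "AMap F f \<cdot>\<^bsub>D\<^esub> AMap F g = Ident D (OMap F (Cod C f))"
    using f g by (simp_all flip: amap_compose)
  ultimately show ?thesis
    unfolding isomorphism_def using f by auto
qed

end

section \<open>Monoidal categories\<close>

context semi_monoidal_category
begin

lemma tensor_obj_closed [simp]: "\<lbrakk>X \<in> Obj C; Y \<in> Obj C\<rbrakk> \<Longrightarrow> X \<otimes> Y \<in> Obj C"
  using tensor.omap_closed [of "(X, Y)"] by (simp add: tensor_obj_def product_category_def)

lemma tensor_simps [simp]: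
  assumes "f \<in> Arr C" "g \<in> Arr C"
  shows "f \<odot> g \<in> Arr C" "Dom C (f \<odot> g) = Dom C f \<otimes> Dom C g"
    "Cod C (f \<odot> g) = Cod C f \<otimes> Cod C g"
  using tensor.amap_simps [of "(f, g)"] assms
  by (simp_all add: tensor_obj_def tensor_arr_def product_category_def)

lemma tensor_ident [simp]:
  "\<lbrakk>X \<in> Obj C; Y \<in> Obj C\<rbrakk> \<Longrightarrow> Ident C X \<odot> Ident C Y = Ident C (X \<otimes> Y)"
  using tensor.amap_ident [of "(X, Y)"]
  by (simp add: tensor_obj_def tensor_arr_def product_category_def)

lemma interchange:
  "\<lbrakk>f \<in> Arr C; g \<in> Arr C; f' \<in> Arr C; g' \<in> Arr C; Dom C g = Cod C f; Dom C g' = Cod C f'\<rbrakk>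
    \<Longrightarrow> (g \<odot> g') \<cdot> (f \<odot> f') = (g \<cdot> f) \<odot> (g' \<cdot> f')"
  using tensor.amap_compose [of "(f, f')" "(g, g')"]
  by (simp add: tensor_arr_def product_category_def)

end

context monoidal_category
begin

abbreviation J where "J \<equiv> Unit C"

lemma unit_obj [simp]: "J \<in> Obj C"
  using LR by (simp add: LR_unit_def)

lemma lunit_nat_iso: "natural_isomorphism C C (left_tensor C J) id_functor (LUnit C)"
  and runit_nat_iso: "natural_isomorphism C C (right_tensor C J) id_functor (RUnit C)"
  using LR by (simp_all add: LR_unit_def)

lemma lunit_simps [simp]:
  assumes "X \<in> Obj C"
  shows "LUnit C X \<in> Arr C" "Dom C (LUnit C X) = J \<otimes> X" "Cod C (LUnit C X) = X"
  using natural_transformation.component_in_hom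
    [OF natural_isomorphism.axioms(1) [OF lunit_nat_iso] assms]
  by (simp_all add: hom_def left_tensor_def id_functor_def)

lemma runit_simps [simp]:
  assumes "X \<in> Obj C"
  shows "RUnit C X \<in> Arr C" "Dom C (RUnit C X) = X \<otimes> J" "Cod C (RUnit C X) = X"
  using natural_transformation.component_in_hom
    [OF natural_isomorphism.axioms(1) [OF runit_nat_iso] assms]
  by (simp_all add: hom_def right_tensor_def id_functor_def)

lemma lunit_iso: "X \<in> Obj C \<Longrightarrow> isomorphism C (LUnit C X)"
  by (rule natural_isomorphism.component_iso [OF lunit_nat_iso])

lemma runit_iso: "X \<in> Obj C \<Longrightarrow> isomorphism C (RUnit C X)"
  by (rule natural_isomorphism.component_iso [OF runit_nat_iso])

lemma lunit_natural:
  "\<lbrakk>f \<in> Arr C; Dom C f = X; Cod C f = Y\<rbrakk> \<Longrightarrow> LUnit C Y \<cdot> (Ident C J \<odot> f) = f \<cdot> LUnit C X"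
  using natural_transformation.naturality
    [OF natural_isomorphism.axioms(1) [OF lunit_nat_iso] homI, of f X Y]
  by (simp add: left_tensor_def id_functor_def)

lemma runit_natural:
  "\<lbrakk>f \<in> Arr C; Dom C f = X; Cod C f = Y\<rbrakk> \<Longrightarrow> RUnit C Y \<cdot> (f \<odot> Ident C J) = f \<cdot> RUnit C X"
  using natural_transformation.naturality
    [OF natural_isomorphism.axioms(1) [OF runit_nat_iso] homI, of f X Y]
  by (simp add: right_tensor_def id_functor_def)

lemma lunit_tensor: "\<lbrakk>X \<in> Obj C; Y \<in> Obj C\<rbrakk> \<Longrightarrow> LUnit C (X \<otimes> Y) = LUnit C X \<odot> Ident C Y"
  and runit_tensor: "\<lbrakk>X \<in> Obj C; Y \<in> Obj C\<rbrakk> \<Longrightarrow> RUnit C (X \<otimes> Y) = Ident C X \<odot> RUnit C Y"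
  using LR by (simp_all add: LR_unit_def)

lemma unit_mult_eq_lunit: "UnitMult C = LUnit C J"
  and unit_mult_eq_runit: "UnitMult C = RUnit C J"
  and unit_mult_tensor: "X \<in> Obj C \<Longrightarrow> UnitMult C \<odot> Ident C X = Ident C J \<odot> LUnit C X"
  and tensor_unit_mult: "X \<in> Obj C \<Longrightarrow> Ident C X \<odot> UnitMult C = RUnit C X \<odot> Ident C J"
  using corresponding unfolding corresponding_units_def by auto

lemma unit_mult_simps [simp]:
  "UnitMult C \<in> Arr C" "Dom C (UnitMult C) = J \<otimes> J" "Cod C (UnitMult C) = J"
  by (simp_all add: unit_mult_eq_lunit)

text \<open>Naturality of \<lambda> expresses \<open>f \<cdot> LUnit C X\<close> through
  \<open>Ident C J \<odot> f\<close>, and \<open>LUnit C X\<close> is epic.\<close>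

lemma unit_tensor_faithful:
  assumes "f \<in> Arr C" "g \<in> Arr C" "Dom C f = Dom C g" "Cod C f = Cod C g"
    and eq: "Ident C J \<odot> f = Ident C J \<odot> g"
  shows "f = g"
proof (rule epiD [OF iso_epi [OF lunit_iso]])
  show "f \<cdot> LUnit C (Dom C f) = g \<cdot> LUnit C (Dom C f)"
    using assms by (metis lunit_natural)
qed (use assms in simp_all)

lemma tensor_unit_faithful:
  assumes "f \<in> Arr C" "g \<in> Arr C" "Dom C f = Dom C g" "Cod C f = Cod C g"
    and eq: "f \<odot> Ident C J = g \<odot> Ident C J"
  shows "f = g"
proof (rule epiD [OF iso_epi [OF runit_iso]])
  show "f \<cdot> RUnit C (Dom C f) = g \<cdot> RUnit C (Dom C f)"
    using assms by (metis runit_natural)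
qed (use assms in simp_all)

text \<open>The naturality square of \<lambda> exhibits \<open>Ident C J \<odot> f\<close> as a
  conjugate of \<open>f\<close> by isomorphisms.\<close>

lemma unit_tensor_epi:
  assumes "epimorphism C f"
  shows "epimorphism C (Ident C J \<odot> f)"
proof -
  have f: "f \<in> Arr C" using assms by (rule epi_arr)
  show ?thesis
    by (rule epi_if_iso_conjugate [OF _ assms lunit_iso [of "Dom C f"] _ _ lunit_iso [of "Cod C f"]])
      (use f in \<open>simp_all add: lunit_natural\<close>)
qed

lemma tensor_unit_epi:
  assumes "epimorphism C f"
  shows "epimorphism C (f \<odot> Ident C J)"
proof -
  have f: "f \<in> Arr C" using assms by (rule epi_arr)
  show ?thesis
    by (rule epi_if_iso_conjugate [OF _ assms runit_iso [of "Dom C f"] _ _ runit_iso [of "Cod C f"]])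
      (use f in \<open>simp_all add: runit_natural\<close>)
qed

section \<open>Semi-monoids with a homomorphism from the unit semi-monoid\<close>

context
  fixes S m u
  assumes S: "S \<in> Obj C"
    and m: "m \<in> Arr C" "Dom C m = S \<otimes> S" "Cod C m = S"
    and u: "u \<in> Arr C" "Dom C u = J" "Cod C u = S"
    and m_assoc: "m \<cdot> (m \<odot> Ident C S) = m \<cdot> (Ident C S \<odot> m)"
    and u_mult: "u \<cdot> UnitMult C = m \<cdot> (u \<odot> u)"
begin

text \<open>Reassociating \<open>?e \<cdot> (Ident C J \<odot> ?e)\<close> brings the two copies of
  \<open>u\<close> together, where the homomorphism law applies. The lemma serves in the target
  category, with \<open>S\<close> the image of the unit.\<close>

lemma gentle_imp_left_unit:
  assumes mono: "monomorphism C (m \<cdot> (u \<odot> Ident C S))"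
  shows "m \<cdot> (u \<odot> Ident C S) = LUnit C S"
proof -
  let ?e = "m \<cdot> (u \<odot> Ident C S)"
  have e: "?e \<in> Arr C" "Dom C ?e = J \<otimes> S" "Cod C ?e = S"
    using S m u by simp_all
  have "?e \<cdot> (Ident C J \<odot> ?e) = m \<cdot> ((u \<odot> Ident C S) \<cdot> (Ident C J \<odot> ?e))"
    using S m u by (simp add: assoc)
  also have "(u \<odot> Ident C S) \<cdot> (Ident C J \<odot> ?e) = u \<odot> ?e"
    using S m u by (simp add: interchange)
  \<comment> \<open>The arrow \<open>u\<close> is split as an identity after \<open>u\<close>, which
    exposes \<open>Ident C S \<odot> m\<close> for the associativity of \<open>m\<close>.\<close>
  also have "u \<odot> ?e = (Ident C S \<odot> m) \<cdot> (u \<odot> u \<odot> Ident C S)"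
    using S m u by (simp add: interchange)
  also have "m \<cdot> (Ident C S \<odot> m) \<cdot> (u \<odot> u \<odot> Ident C S)
      = (m \<cdot> (Ident C S \<odot> m)) \<cdot> (u \<odot> u \<odot> Ident C S)"
    using S m u by (simp add: assoc)
  also have "\<dots> = (m \<cdot> (m \<odot> Ident C S)) \<cdot> ((u \<odot> u) \<odot> Ident C S)"
    using S u by (simp add: m_assoc tensor_arr_assoc)
  also have "\<dots> = m \<cdot> ((m \<cdot> (u \<odot> u)) \<odot> Ident C S)"
    using S m u by (simp add: assoc interchange)
  also have "(m \<cdot> (u \<odot> u)) \<odot> Ident C S = (u \<odot> Ident C S) \<cdot> (UnitMult C \<odot> Ident C S)"
    using S u by (simp add: interchange flip: u_mult)
  \<comment> \<open>Here the correspondence of the two unit structures enters: \<beta> tensored with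
    \<open>S\<close> on the right is \<open>J\<close> tensored with \<lambda> at
    \<open>S\<close>.\<close>
  also have "m \<cdot> \<dots> = ?e \<cdot> (Ident C J \<odot> LUnit C S)"
    using S m u by (simp add: assoc unit_mult_tensor)
  finally have "?e \<cdot> (Ident C J \<odot> ?e) = ?e \<cdot> (Ident C J \<odot> LUnit C S)" .
  then have "Ident C J \<odot> ?e = Ident C J \<odot> LUnit C S"
    by (rule monoD [OF mono, rotated -1]) (use S e in simp_all)
  then show ?thesis
    by (rule unit_tensor_faithful [rotated -1]) (use S e in simp_all)
qed

text \<open>Mirror image of the left case: \<rho> replaces \<lambda>, and \<open>J\<close> is
  cancelled on the right.\<close>

lemma gentle_imp_right_unit:
  assumes mono: "monomorphism C (m \<cdot> (Ident C S \<odot> u))"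
  shows "m \<cdot> (Ident C S \<odot> u) = RUnit C S"
proof -
  let ?e = "m \<cdot> (Ident C S \<odot> u)"
  have e: "?e \<in> Arr C" "Dom C ?e = S \<otimes> J" "Cod C ?e = S"
    using S m u by simp_all
  have "?e \<cdot> (?e \<odot> Ident C J) = m \<cdot> ((Ident C S \<odot> u) \<cdot> (?e \<odot> Ident C J))"
    using S m u by (simp add: assoc)
  also have "(Ident C S \<odot> u) \<cdot> (?e \<odot> Ident C J) = ?e \<odot> u"
    using S m u by (simp add: interchange)
  also have "?e \<odot> u = (m \<odot> Ident C S) \<cdot> ((Ident C S \<odot> u) \<odot> u)"
    using S m u by (simp add: interchange)
  also have "m \<cdot> (m \<odot> Ident C S) \<cdot> ((Ident C S \<odot> u) \<odot> u)
      = (m \<cdot> (m \<odot> Ident C S)) \<cdot> ((Ident C S \<odot> u) \<odot> u)"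
    using S m u by (simp add: assoc)
  also have "\<dots> = (m \<cdot> (Ident C S \<odot> m)) \<cdot> (Ident C S \<odot> u \<odot> u)"
    using S m u by (simp add: m_assoc tensor_arr_assoc)
  also have "\<dots> = m \<cdot> (Ident C S \<odot> (m \<cdot> (u \<odot> u)))"
    using S m u by (simp add: assoc interchange)
  also have "Ident C S \<odot> (m \<cdot> (u \<odot> u)) = (Ident C S \<odot> u) \<cdot> (Ident C S \<odot> UnitMult C)"
    using S u by (simp add: interchange flip: u_mult)
  also have "m \<cdot> \<dots> = ?e \<cdot> (RUnit C S \<odot> Ident C J)"
    using S m u tensor_unit_mult [OF S] by (simp add: assoc tensor_obj_assoc)
  finally have "?e \<cdot> (?e \<odot> Ident C J) = ?e \<cdot> (RUnit C S \<odot> Ident C J)" .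
  then have "?e \<odot> Ident C J = RUnit C S \<odot> Ident C J"
    by (rule monoD [OF mono, rotated -1]) (use S e in simp_all)
  then show ?thesis
    by (rule tensor_unit_faithful [rotated -1]) (use S e in simp_all)
qed

end

end

section \<open>Lax multiplicative functors between monoidal categories\<close>

text \<open>The arrow \<open>u\<close> is the candidate \<open>\<phi>\<^sub>0\<close>. Only its type
  is assumed, so that either compatibility can serve as the hypothesis later.\<close>

locale lax_multiplicative_monoidal =
  source: monoidal_category C + target: monoidal_category D +
  lax_multiplicative_functor C D F \<phi>
  for C :: "('o, 'a, 'm) monoidal_category_scheme"
    and D :: "('p, 'b, 'n) monoidal_category_scheme"
    and F :: "('o, 'a, 'p, 'b) functor_maps"
    and \<phi> :: "'o \<times> 'o \<Rightarrow> 'b" +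
  fixes u :: 'b
  assumes u_hom: "u \<in> hom D (Unit D) (OMap F (Unit C))"
begin

abbreviation comp_D (infixr "\<cdot>" 55) where "g \<cdot> f \<equiv> g \<cdot>\<^bsub>D\<^esub> f"
abbreviation tensor_D (infixr "\<odot>" 70) where "f \<odot> g \<equiv> f \<odot>\<^bsub>D\<^esub> g"
abbreviation id_F where "id_F X \<equiv> Ident D (OMap F X)"
abbreviation I where "I \<equiv> Unit C"
abbreviation J where "J \<equiv> Unit D"

lemmas u_simps [simp] = homD [OF u_hom]

lemma mult_simps [simp]:
  assumes "X \<in> Obj C" "Y \<in> Obj C"
  shows "\<phi> (X, Y) \<in> Arr D" "Dom D (\<phi> (X, Y)) = OMap F X \<otimes>\<^bsub>D\<^esub> OMap F Y"
    "Cod D (\<phi> (X, Y)) = OMap F (X \<otimes>\<^bsub>C\<^esub> Y)"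
  using mult.component_in_hom [of "(X, Y)"] assms
  by (simp_all add: hom_def product_category_def comp_functor_def product_functor_def tensor_obj_def)

lemma mult_natural:
  assumes "f \<in> Arr C" "g \<in> Arr C" "Dom C f = X" "Cod C f = X'" "Dom C g = Y" "Cod C g = Y'"
  shows "\<phi> (X', Y') \<cdot> (AMap F f \<odot> AMap F g) = AMap F (f \<odot>\<^bsub>C\<^esub> g) \<cdot> \<phi> (X, Y)"
  using mult.naturality [of "(f, g)" "(X, Y)" "(X', Y')"] assms
  by (simp add: hom_def product_category_def comp_functor_def product_functor_def tensor_arr_def)

text \<open>The action of the semi-monoid \<open>F(I)\<close> on \<open>F(X)\<close>; at
  \<open>X = I\<close> it is the multiplication \<open>m\<close>. Precomposing it with
  \<open>u \<odot> id_F X\<close> gives the arrow \<open>e\<^sub>X\<close> of the overview.\<close>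

definition left_action :: "'o \<Rightarrow> 'b" where
  "left_action X = AMap F (LUnit C X) \<cdot> \<phi> (I, X)"

definition right_action :: "'o \<Rightarrow> 'b" where
  "right_action X = AMap F (RUnit C X) \<cdot> \<phi> (X, I)"

lemma action_simps [simp]:
  assumes "X \<in> Obj C"
  shows "left_action X \<in> Arr D" "Dom D (left_action X) = OMap F I \<otimes>\<^bsub>D\<^esub> OMap F X"
    "Cod D (left_action X) = OMap F X"
    "right_action X \<in> Arr D" "Dom D (right_action X) = OMap F X \<otimes>\<^bsub>D\<^esub> OMap F I"
    "Cod D (right_action X) = OMap F X"
  using assms by (simp_all add: left_action_def right_action_def)

text \<open>The naturality squares of \<phi> in its second argument and of \<lambda> are pasted, the
  latter under \<open>F\<close>.\<close>

lemma left_action_natural: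
  assumes f: "f \<in> Arr C" "Dom C f = X" "Cod C f = Y"
  shows "left_action Y \<cdot> (id_F I \<odot> AMap F f) = AMap F f \<cdot> left_action X"
proof -
  have XY: "X \<in> Obj C" "Y \<in> Obj C" using f by auto
  \<comment> \<open>The identity of \<open>F(I)\<close> is written as the image of an identity, the
    shape that naturality of \<phi> in two variables requires.\<close>
  have "left_action Y \<cdot> (id_F I \<odot> AMap F f)
      = AMap F (LUnit C Y) \<cdot> \<phi> (I, Y) \<cdot> (AMap F (Ident C I) \<odot> AMap F f)"
    using f XY by (simp add: left_action_def target.assoc)
  also have "\<dots> = AMap F (LUnit C Y) \<cdot> AMap F (Ident C I \<odot>\<^bsub>C\<^esub> f) \<cdot> \<phi> (I, X)"
    using f by (subst mult_natural) simp_all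
  also have "\<dots> = AMap F (LUnit C Y \<cdot>\<^bsub>C\<^esub> (Ident C I \<odot>\<^bsub>C\<^esub> f)) \<cdot> \<phi> (I, X)"
    using f XY by (simp add: amap_compose target.assoc)
  also have "\<dots> = AMap F f \<cdot> left_action X"
    using f XY
    by (simp add: source.lunit_natural [OF f] amap_compose target.assoc left_action_def)
  finally show ?thesis .
qed

lemma right_action_natural:
  assumes f: "f \<in> Arr C" "Dom C f = X" "Cod C f = Y"
  shows "right_action Y \<cdot> (AMap F f \<odot> id_F I) = AMap F f \<cdot> right_action X"
proof -
  have XY: "X \<in> Obj C" "Y \<in> Obj C" using f by auto
  have "right_action Y \<cdot> (AMap F f \<odot> id_F I)
      = AMap F (RUnit C Y) \<cdot> \<phi> (Y, I) \<cdot> (AMap F f \<odot> AMap F (Ident C I))"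
    using f XY by (simp add: right_action_def target.assoc)
  also have "\<dots> = AMap F (RUnit C Y) \<cdot> AMap F (f \<odot>\<^bsub>C\<^esub> Ident C I) \<cdot> \<phi> (X, I)"
    using f by (subst mult_natural) simp_all
  also have "\<dots> = AMap F (RUnit C Y \<cdot>\<^bsub>C\<^esub> (f \<odot>\<^bsub>C\<^esub> Ident C I)) \<cdot> \<phi> (X, I)"
    using f XY by (simp add: amap_compose target.assoc)
  also have "\<dots> = AMap F f \<cdot> right_action X"
    using f XY
    by (simp add: source.runit_natural [OF f] amap_compose target.assoc right_action_def)
  finally show ?thesis .
qed

text \<open>\<phi> respects the left actions, where \<open>F(I)\<close> acts on a product through
  its first factor. This combines \<lambda> at \<open>XY\<close> being \<lambda> at \<open>X\<close>
  tensored with \<open>Y\<close>, associativity of \<phi>, and its naturality.\<close>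

lemma left_action_mult:
  assumes [simp]: "X \<in> Obj C" "Y \<in> Obj C"
  shows "left_action (X \<otimes>\<^bsub>C\<^esub> Y) \<cdot> (id_F I \<odot> \<phi> (X, Y)) = \<phi> (X, Y) \<cdot> (left_action X \<odot> id_F Y)"
proof -
  have "left_action (X \<otimes>\<^bsub>C\<^esub> Y) \<cdot> (id_F I \<odot> \<phi> (X, Y))
      = AMap F (LUnit C X \<odot>\<^bsub>C\<^esub> Ident C Y) \<cdot> \<phi> (I, X \<otimes>\<^bsub>C\<^esub> Y) \<cdot> (id_F I \<odot> \<phi> (X, Y))"
    by (simp add: left_action_def target.assoc source.lunit_tensor source.tensor_obj_assoc)
  also have "\<dots> = AMap F (LUnit C X \<odot>\<^bsub>C\<^esub> Ident C Y) \<cdot> \<phi> (I \<otimes>\<^bsub>C\<^esub> X, Y) \<cdot> (\<phi> (I, X) \<odot> id_F Y)"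
    by (simp add: mult_assoc)
  also have "\<dots> = (AMap F (LUnit C X \<odot>\<^bsub>C\<^esub> Ident C Y) \<cdot> \<phi> (I \<otimes>\<^bsub>C\<^esub> X, Y)) \<cdot> (\<phi> (I, X) \<odot> id_F Y)"
    by (simp add: target.assoc)
  also have "AMap F (LUnit C X \<odot>\<^bsub>C\<^esub> Ident C Y) \<cdot> \<phi> (I \<otimes>\<^bsub>C\<^esub> X, Y)
      = \<phi> (X, Y) \<cdot> (AMap F (LUnit C X) \<odot> id_F Y)"
    by (subst mult_natural [symmetric]) simp_all
  also have "(\<phi> (X, Y) \<cdot> (AMap F (LUnit C X) \<odot> id_F Y)) \<cdot> (\<phi> (I, X) \<odot> id_F Y)
      = \<phi> (X, Y) \<cdot> (left_action X \<odot> id_F Y)"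
    by (simp add: target.assoc target.interchange left_action_def)
  finally show ?thesis .
qed

text \<open>The counterpart for right actions, through the second factor; it rests on \<rho> at
  \<open>XY\<close> being \<open>X\<close> tensored with \<rho> at \<open>Y\<close>.\<close>

lemma right_action_mult:
  assumes [simp]: "X \<in> Obj C" "Y \<in> Obj C"
  shows "right_action (X \<otimes>\<^bsub>C\<^esub> Y) \<cdot> (\<phi> (X, Y) \<odot> id_F I) = \<phi> (X, Y) \<cdot> (id_F X \<odot> right_action Y)"
proof -
  have "right_action (X \<otimes>\<^bsub>C\<^esub> Y) \<cdot> (\<phi> (X, Y) \<odot> id_F I)
      = AMap F (Ident C X \<odot>\<^bsub>C\<^esub> RUnit C Y) \<cdot> \<phi> (X \<otimes>\<^bsub>C\<^esub> Y, I) \<cdot> (\<phi> (X, Y) \<odot> id_F I)"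
    by (simp add: right_action_def target.assoc source.runit_tensor source.tensor_obj_assoc)
  also have "\<dots> = AMap F (Ident C X \<odot>\<^bsub>C\<^esub> RUnit C Y) \<cdot> \<phi> (X, Y \<otimes>\<^bsub>C\<^esub> I) \<cdot> (id_F X \<odot> \<phi> (Y, I))"
    by (simp add: mult_assoc)
  also have "\<dots> = (AMap F (Ident C X \<odot>\<^bsub>C\<^esub> RUnit C Y) \<cdot> \<phi> (X, Y \<otimes>\<^bsub>C\<^esub> I)) \<cdot> (id_F X \<odot> \<phi> (Y, I))"
    by (simp add: target.assoc)
  also have "AMap F (Ident C X \<odot>\<^bsub>C\<^esub> RUnit C Y) \<cdot> \<phi> (X, Y \<otimes>\<^bsub>C\<^esub> I)
      = \<phi> (X, Y) \<cdot> (id_F X \<odot> AMap F (RUnit C Y))"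
    by (subst mult_natural [symmetric]) simp_all
  also have "(\<phi> (X, Y) \<cdot> (id_F X \<odot> AMap F (RUnit C Y))) \<cdot> (id_F X \<odot> \<phi> (Y, I))
      = \<phi> (X, Y) \<cdot> (id_F X \<odot> right_action Y)"
    by (simp add: target.assoc target.interchange right_action_def)
  finally show ?thesis .
qed

text \<open>Both sides are the multiplication of \<open>F(I)\<close>, because \<lambda> and \<rho>
  at \<open>I\<close> both equal \<alpha>. Hence one associative \<open>m\<close> serves the left
  and the right unit law.\<close>

lemma right_action_unit: "right_action I = left_action I"
  unfolding left_action_def right_action_def
  by (simp flip: source.unit_mult_eq_lunit source.unit_mult_eq_runit)

text \<open>Associativity of \<open>m\<close> comes from compatibility of the action with
  \<open>\<phi> (I, I)\<close>, followed by naturality of the action along \<lambda> at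
  \<open>I\<close>.\<close>

lemma unit_image_assoc:
  "left_action I \<cdot> (left_action I \<odot> id_F I) = left_action I \<cdot> (id_F I \<odot> left_action I)"
proof -
  have "left_action I \<cdot> (left_action I \<odot> id_F I)
      = AMap F (LUnit C I) \<cdot> \<phi> (I, I) \<cdot> (left_action I \<odot> id_F I)"
    by (simp add: left_action_def target.assoc)
  also have "\<dots> = (AMap F (LUnit C I) \<cdot> left_action (I \<otimes>\<^bsub>C\<^esub> I)) \<cdot> (id_F I \<odot> \<phi> (I, I))"
    by (simp add: target.assoc left_action_mult)
  also have "\<dots> = (left_action I \<cdot> (id_F I \<odot> AMap F (LUnit C I))) \<cdot> (id_F I \<odot> \<phi> (I, I))"
    by (subst left_action_natural [symmetric]) simp_all
  also have "\<dots> = left_action I \<cdot> (id_F I \<odot> left_action I)"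
    by (simp add: target.assoc target.interchange left_action_def)
  finally show ?thesis .
qed

text \<open>Spreads the unit law from \<open>I\<close> to \<open>X\<close> in two stages: to
  \<open>IX\<close>, because \<open>\<phi> (I, X)\<close> is epic, and then along the isomorphism
  \<open>F(\<lambda>)\<close> to \<open>X\<close>.\<close>

lemma left_unit_of_epi:
  assumes X [simp]: "X \<in> Obj C"
    and unit: "left_action I \<cdot> (u \<odot> id_F I) = LUnit D (OMap F I)"
    and epi: "epimorphism D (\<phi> (I, X))"
  shows "left_action X \<cdot> (u \<odot> id_F X) = LUnit D (OMap F X)"
proof -
  let ?e = "\<lambda>X. left_action X \<cdot> (u \<odot> id_F X)"
  let ?IX = "I \<otimes>\<^bsub>C\<^esub> X" and ?p = "\<phi> (I, X)" and ?l = "AMap F (LUnit C X)"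
  have "?e ?IX \<cdot> (Ident D J \<odot> ?p) = left_action ?IX \<cdot> (u \<odot> ?p)"
    by (simp add: target.assoc target.interchange)
  also have "u \<odot> ?p = (id_F I \<odot> ?p) \<cdot> ((u \<odot> id_F I) \<odot> id_F X)"
    by (simp add: target.interchange target.tensor_arr_assoc)
  also have "left_action ?IX \<cdot> \<dots>
      = (left_action ?IX \<cdot> (id_F I \<odot> ?p)) \<cdot> ((u \<odot> id_F I) \<odot> id_F X)"
    by (simp add: target.assoc target.tensor_obj_assoc)
  also have "\<dots> = ?p \<cdot> (?e I \<odot> id_F X)"
    by (simp add: left_action_mult target.assoc target.interchange)
  \<comment> \<open>The law at \<open>I\<close> turns \<open>?e I \<odot> id_F X\<close> into
    \<lambda> at the product \<open>F(I)F(X)\<close>, which naturality moves past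
    \<open>?p\<close>.\<close>
  also have "\<dots> = LUnit D (OMap F ?IX) \<cdot> (Ident D J \<odot> ?p)"
    by (simp add: unit target.lunit_natural target.lunit_tensor)
  finally have IX: "?e ?IX = LUnit D (OMap F ?IX)"
    by (rule target.epiD [OF target.unit_tensor_epi [OF epi], rotated -1]) simp_all
  show ?thesis
  \<comment> \<open>The equation at \<open>X\<close> is tested against \<open>J\<close> tensored
    with the invertible \<open>?l\<close>, reducing it to the case \<open>IX\<close>.\<close>
  proof (rule target.epiD [OF target.unit_tensor_epi
        [OF target.iso_epi [OF amap_iso [OF source.lunit_iso [OF X]]]]])
    have "?e X \<cdot> (Ident D J \<odot> ?l) = left_action X \<cdot> (u \<odot> ?l)"
      by (simp add: target.assoc target.interchange)
    also have "u \<odot> ?l = (id_F I \<odot> ?l) \<cdot> (u \<odot> id_F ?IX)"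
      by (simp add: target.interchange)
    also have "left_action X \<cdot> \<dots> = (left_action X \<cdot> (id_F I \<odot> ?l)) \<cdot> (u \<odot> id_F ?IX)"
      by (simp add: target.assoc)
    also have "\<dots> = ?l \<cdot> ?e ?IX"
      by (simp add: left_action_natural [of "LUnit C X" ?IX X] target.assoc)
    also have "\<dots> = LUnit D (OMap F X) \<cdot> (Ident D J \<odot> ?l)"
      by (simp add: IX target.lunit_natural)
    finally show "?e X \<cdot> (Ident D J \<odot> ?l) = LUnit D (OMap F X) \<cdot> (Ident D J \<odot> ?l)" .
  qed simp_all
qed

text \<open>The same two stages on the other side, through \<open>XI\<close> and along
  \<open>F(\<rho>)\<close>.\<close>

lemma right_unit_of_epi:
  assumes X [simp]: "X \<in> Obj C"
    and unit: "right_action I \<cdot> (id_F I \<odot> u) = RUnit D (OMap F I)"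
    and epi: "epimorphism D (\<phi> (X, I))"
  shows "right_action X \<cdot> (id_F X \<odot> u) = RUnit D (OMap F X)"
proof -
  let ?e = "\<lambda>X. right_action X \<cdot> (id_F X \<odot> u)"
  let ?XI = "X \<otimes>\<^bsub>C\<^esub> I" and ?p = "\<phi> (X, I)" and ?r = "AMap F (RUnit C X)"
  have "?e ?XI \<cdot> (?p \<odot> Ident D J) = right_action ?XI \<cdot> (?p \<odot> u)"
    by (simp add: target.assoc target.interchange)
  also have "?p \<odot> u = (?p \<odot> id_F I) \<cdot> (id_F X \<odot> (id_F I \<odot> u))"
    by (simp add: target.interchange flip: target.tensor_arr_assoc)
  also have "right_action ?XI \<cdot> \<dots>
      = (right_action ?XI \<cdot> (?p \<odot> id_F I)) \<cdot> (id_F X \<odot> (id_F I \<odot> u))"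
    by (simp add: target.assoc target.tensor_obj_assoc)
  also have "\<dots> = ?p \<cdot> (id_F X \<odot> ?e I)"
    by (simp add: right_action_mult target.assoc target.interchange)
  also have "\<dots> = RUnit D (OMap F ?XI) \<cdot> (?p \<odot> Ident D J)"
    by (simp add: unit target.runit_natural target.runit_tensor)
  finally have XI: "?e ?XI = RUnit D (OMap F ?XI)"
    by (rule target.epiD [OF target.tensor_unit_epi [OF epi], rotated -1]) simp_all
  show ?thesis
  proof (rule target.epiD [OF target.tensor_unit_epi
        [OF target.iso_epi [OF amap_iso [OF source.runit_iso [OF X]]]]])
    have "?e X \<cdot> (?r \<odot> Ident D J) = right_action X \<cdot> (?r \<odot> u)"
      by (simp add: target.assoc target.interchange)
    also have "?r \<odot> u = (?r \<odot> id_F I) \<cdot> (id_F ?XI \<odot> u)"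
      by (simp add: target.interchange)
    also have "right_action X \<cdot> \<dots> = (right_action X \<cdot> (?r \<odot> id_F I)) \<cdot> (id_F ?XI \<odot> u)"
      by (simp add: target.assoc)
    also have "\<dots> = ?r \<cdot> ?e ?XI"
      by (simp add: right_action_natural [of "RUnit C X" ?XI X] target.assoc)
    also have "\<dots> = RUnit D (OMap F X) \<cdot> (?r \<odot> Ident D J)"
      by (simp add: XI target.runit_natural)
    finally show "?e X \<cdot> (?r \<odot> Ident D J) = RUnit D (OMap F X) \<cdot> (?r \<odot> Ident D J)" .
  qed simp_all
qed

section \<open>Comparison of the two compatibility conditions\<close>

lemma LR_unit_compatibility_iff:
  "LR_unit_compatibility C D F \<phi> u \<longleftrightarrow> (\<forall>X \<in> Obj C.
    left_action X \<cdot> (u \<odot> id_F X) = LUnit D (OMap F X) \<and>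
    right_action X \<cdot> (id_F X \<odot> u) = RUnit D (OMap F X))"
  unfolding LR_unit_compatibility_def
  by (auto simp: u_hom left_action_def right_action_def target.assoc)

lemma semi_monoid_hom_iff:
  "semi_monoid_hom C D F \<phi> u \<longleftrightarrow> u \<cdot> UnitMult D = left_action I \<cdot> (u \<odot> u)"
  unfolding semi_monoid_hom_def
  by (simp add: left_action_def target.assoc flip: source.unit_mult_eq_lunit)

text \<open>As \<alpha> is \<lambda> at \<open>I\<close>, both composites share the factor
  \<open>left_action I\<close>; the rest is rebracketing.\<close>

lemma gentle_iff:
  "gentle C D F \<phi> u \<longleftrightarrow> monomorphism D (left_action I \<cdot> (u \<odot> id_F I)) \<and>
    monomorphism D (left_action I \<cdot> (id_F I \<odot> u))"
  unfolding gentle_def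
  by (simp add: left_action_def target.assoc flip: source.unit_mult_eq_lunit)

lemma Saavedra_if_LR:
  assumes "LR_unit_compatibility C D F \<phi> u"
  shows "Saavedra_unit_compatibility C D F \<phi> u"
proof -
  have l: "left_action X \<cdot> (u \<odot> id_F X) = LUnit D (OMap F X)"
    and r: "right_action X \<cdot> (id_F X \<odot> u) = RUnit D (OMap F X)" if "X \<in> Obj C" for X
    using assms that by (simp_all add: LR_unit_compatibility_iff)
  \<comment> \<open>Condition (a) starts from naturality of \<lambda> in the target along
    \<open>u\<close>, since \<beta> is \<lambda> at \<open>J\<close>.\<close>
  have "u \<cdot> UnitMult D = LUnit D (OMap F I) \<cdot> (Ident D J \<odot> u)"
    by (simp add: target.lunit_natural target.unit_mult_eq_lunit)
  also have "\<dots> = left_action I \<cdot> (u \<odot> u)"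
    by (simp add: target.assoc target.interchange flip: l)
  finally have "semi_monoid_hom C D F \<phi> u"
    by (simp add: semi_monoid_hom_iff)
  moreover have "gentle C D F \<phi> u"
    using l [of I] r [of I] target.iso_mono target.lunit_iso target.runit_iso
    by (simp add: gentle_iff right_action_unit)
  moreover have "epimorphism D (\<phi> (I, X))" if [simp]: "X \<in> Obj C" for X
  \<comment> \<open>\<open>\<phi> (I, X)\<close> is the middle factor of a composite that equals the
    invertible \<lambda> at \<open>F(X)\<close>, and the last factor is invertible too.\<close>
  proof (rule target.epi_if_iso_composite [where h = "AMap F (LUnit C X)" and f = "u \<odot> id_F X"])
    show "isomorphism D (AMap F (LUnit C X) \<cdot> \<phi> (I, X) \<cdot> (u \<odot> id_F X))"
      using l [of X] target.lunit_iso [of "OMap F X"] by (simp add: left_action_def target.assoc)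
  qed (simp_all add: amap_iso source.lunit_iso)
  moreover have "epimorphism D (\<phi> (X, I))" if [simp]: "X \<in> Obj C" for X
  proof (rule target.epi_if_iso_composite [where h = "AMap F (RUnit C X)" and f = "id_F X \<odot> u"])
    show "isomorphism D (AMap F (RUnit C X) \<cdot> \<phi> (X, I) \<cdot> (id_F X \<odot> u))"
      using r [of X] target.runit_iso [of "OMap F X"] by (simp add: right_action_def target.assoc)
  qed (simp_all add: amap_iso source.runit_iso)
  ultimately show ?thesis
    by (simp add: Saavedra_unit_compatibility_def u_hom)
qed

lemma LR_if_Saavedra:
  assumes "Saavedra_unit_compatibility C D F \<phi> u"
  shows "LR_unit_compatibility C D F \<phi> u"
proof -
  have hom: "u \<cdot> UnitMult D = left_action I \<cdot> (u \<odot> u)"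
    and mono_l: "monomorphism D (left_action I \<cdot> (u \<odot> id_F I))"
    and mono_r: "monomorphism D (left_action I \<cdot> (id_F I \<odot> u))"
    and epi: "\<And>X. X \<in> Obj C \<Longrightarrow> epimorphism D (\<phi> (I, X))"
      "\<And>X. X \<in> Obj C \<Longrightarrow> epimorphism D (\<phi> (X, I))"
    using assms
    by (simp_all add: Saavedra_unit_compatibility_def semi_monoid_hom_iff gentle_iff)
  have "left_action I \<cdot> (u \<odot> id_F I) = LUnit D (OMap F I)"
    \<comment> \<open>The semi-monoid is \<open>F(I)\<close> with multiplication
      \<open>left_action I\<close>; the seven open premises are typing conditions.\<close>
    by (rule target.gentle_imp_left_unit [OF _ _ _ _ _ _ _ unit_image_assoc hom mono_l]) simp_all
  moreover have "right_action I \<cdot> (id_F I \<odot> u) = RUnit D (OMap F I)"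
    unfolding right_action_unit
    by (rule target.gentle_imp_right_unit [OF _ _ _ _ _ _ _ unit_image_assoc hom mono_r]) simp_all
  ultimately show ?thesis
    by (simp add: LR_unit_compatibility_iff left_unit_of_epi right_unit_of_epi epi)
qed

end

theorem proposition6p2:
  fixes C :: "('o, 'a) monoidal_category"
    and D :: "('p, 'b) monoidal_category"
    and F :: "('o, 'a, 'p, 'b) functor_maps"
    and \<phi> :: "'o \<times> 'o \<Rightarrow> 'b"
    and \<phi>0 :: 'b
  assumes "monoidal_category C"
    and "monoidal_category D"
    and "lax_multiplicative_functor C D F \<phi>"
    and "\<phi>0 \<in> hom D (Unit D) (OMap F (Unit C))"
  shows "LR_unit_compatibility C D F \<phi> \<phi>0 \<longleftrightarrow> Saavedra_unit_compatibility C D F \<phi> \<phi>0"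
proof -
  interpret lax_multiplicative_monoidal C D F \<phi> \<phi>0
    using assms by (intro lax_multiplicative_monoidal.intro lax_multiplicative_monoidal_axioms.intro)
  show ?thesis
    using Saavedra_if_LR LR_if_Saavedra by blast
qed

end
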